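(* Let $K$ be a local field of characteristic $p$, let $\psi$ be a Drinfeld $A$-module of good reduction over $\mathcal O_K$, and let $\bar\phi$ be its reduction modulo $\mathfrak m_K$, viewed again as a Drinfeld module over $\mathcal O_K$ via $k\hookrightarrow\mathcal O_K$. Set $w:=\inf\{v(\psi_a-\bar\phi_a)\mid a\in A\}$. (a) There exists a unique element $x=\sum_{j\le0}x_j\tau^j$ with all $x_j\in\mathcal O_K$ and $x\equiv1$ modulo $\mathfrak m_K$ such that $\psi_a x=x\bar\phi_a$ for all $a\in A$. (b) This element possesses a two-sided inverse $x^{-1}=\sum_{j\le0}y_j\tau^j$ in $\mathcal O_{K^{\rm perf}}[[\tau^{-1}]]$. (c) These elements satisfy the bounds $v(x-1)\ge w$ and $v(x^{-1}-1)\ge w$.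
   Context: $K$ is a local field of characteristic $p$ with valuation ring $\mathcal O_K$, maximal ideal $\mathfrak m_K$, finite residue field $k$, and normalized valuation $v$, extended to the perfection $K^{\rm perf}$, whose valuation ring is $\mathcal O_{K^{\rm perf}}$. There is a unique ring section $k\hookrightarrow\mathcal O_K$ of $\mathcal O_K\to k$, by which $k\subset\mathcal O_K$. For a perfect commutative $\mathbb F_p$-algebra $S$, $S((\tau^{-1}))$ is the ring of formal Laurent series $\sum_{i}x_i\tau^i$ with $x_i\in S$, $x_i=0$ for $i\gg0$, with multiplication determined by $\tau^ix=x^{p^i}\tau^i$ for all $i\in\mathbb Z$; it contains the twisted polynomial ring $S[\tau]$ and the subring $S[[\tau^{-1}]]$ of series with $x_i=0$ for $i>0$. The equations are taken in $\mathcal O_{K^{\rm perf}}((\tau^{-1}))$. For $x=\sum_ix_i\tau^i$ in this ring, $v(x):=\inf_i v(x_i)$. The condition $x\equiv1$ modulo $\mathfrak m_K$ means $x_0-1\in\mathfrak m_K$ and $x_j\in\mathfrak m_K$ for $j<0$. $A$ is an admissible coefficient ring for Drinfeld modules: the ring of elements of a global function field $F$ of characteristic $p$ that are regular outside a fixed place $\infty$. A Drinfeld $A$-module $\psi$ of good reduction over $\mathcal O_K$ is a ring homomorphism $A\to\mathcal O_K[\tau]$, $a\mapsto\psi_a$, of positive rank (i.e. $\psi(A)\not\subset\mathcal O_K$), such that for every $a\ne0$ the highest coefficient of $\psi_a$ is a unit in $\mathcal O_K$. Its reduction $\bar\phi:A\to k[\tau]$ is a Drinfeld $A$-module over $k$.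 *)

theory Defs
  imports "HOL-Analysis.Analysis"
begin

section \<open>Perfect rings of prime characteristic and integral Frobenius powers\<close>

class perfect_ring_prime_char = comm_ring_prime_char +
  assumes bij_frobenius: "bij (\<lambda>x. x ^ CHAR('a))"

text \<open>\<open>frob_pow i x\<close> is \<open>x\<close> raised to the power \<open>p\<^sup>i\<close>, also for negative \<open>i\<close>.\<close>

definition frob_pow :: "int \<Rightarrow> 'a::perfect_ring_prime_char \<Rightarrow> 'a" where
  "frob_pow i x =
    (if 0 \<le> i then x ^ (CHAR('a) ^ nat i) else (THE y. y ^ (CHAR('a) ^ nat (- i)) = x))"

lemma bij_frob_power:
  "bij (\<lambda>x::'a::perfect_ring_prime_char. x ^ (CHAR('a) ^ n))"
proof (induction n)
  case 0
  show ?case by (simp add: bij_def inj_on_def surj_def)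
next
  case (Suc n)
  have "(\<lambda>x::'a. x ^ (CHAR('a) ^ Suc n)) = (\<lambda>x. x ^ (CHAR('a) ^ n)) \<circ> (\<lambda>x. x ^ CHAR('a))"
    by (auto simp: power_mult)
  then show ?case using bij_comp[OF bij_frobenius Suc.IH] by simp
qed

lemma frob_pow_inj:
  "(x::'a::perfect_ring_prime_char) ^ (CHAR('a) ^ n) = y ^ (CHAR('a) ^ n) \<Longrightarrow> x = y"
  using bij_frob_power[of n] by (auto simp: bij_def inj_on_def)

lemma frob_pow_char:
  fixes x :: "'a::perfect_ring_prime_char"
  assumes "0 \<le> int n + i"
  shows "(frob_pow i x) ^ (CHAR('a) ^ n) = x ^ (CHAR('a) ^ nat (int n + i))"
proof (cases "0 \<le> i")
  case True
  then have "nat (int n + i) = nat i + n" by simp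
  with True show ?thesis by (simp add: frob_pow_def power_add power_mult)
next
  case False
  define m where "m = nat (- i)"
  have "\<exists>!y. y ^ (CHAR('a) ^ m) = x"
    using bij_frob_power[of m, where ?'a = 'a] unfolding bij_iff by blast
  from theI'[OF this] have *: "(frob_pow i x) ^ (CHAR('a) ^ m) = x"
    using False by (simp add: frob_pow_def m_def)
  have n: "n = m + nat (int n + i)" using False assms by (simp add: m_def)
  have "(frob_pow i x) ^ (CHAR('a) ^ n)
      = ((frob_pow i x) ^ (CHAR('a) ^ m)) ^ (CHAR('a) ^ nat (int n + i))"
    by (subst n) (simp add: power_add power_mult)
  with * show ?thesis by simp
qed

lemma frob_pow_unique:
  fixes x :: "'a::perfect_ring_prime_char"
  assumes "y ^ (CHAR('a) ^ nat (- i)) = x ^ (CHAR('a) ^ nat i)"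
  shows "frob_pow i x = y"
proof (rule frob_pow_inj)
  have "nat (int (nat (- i)) + i) = nat i" by simp
  with frob_pow_char[of "nat (- i)" i x] assms
  show "frob_pow i x ^ CHAR('a) ^ nat (- i) = y ^ CHAR('a) ^ nat (- i)" by simp
qed

lemma frob_pow_0 [simp]: "frob_pow 0 x = x"
  by (simp add: frob_pow_def)

lemma frob_pow_zero [simp]: "frob_pow i (0::'a::perfect_ring_prime_char) = 0"
  by (rule frob_pow_unique) (simp add: power_0_left)

lemma frob_pow_one [simp]: "frob_pow i (1::'a::perfect_ring_prime_char) = 1"
  by (rule frob_pow_unique) simp

lemma frob_pow_add:
  "frob_pow i (x + y :: 'a::perfect_ring_prime_char) = frob_pow i x + frob_pow i y"
  by (rule frob_pow_unique) (simp add: freshmans_dream' frob_pow_char)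

lemma frob_pow_mult:
  "frob_pow i (x * y :: 'a::perfect_ring_prime_char) = frob_pow i x * frob_pow i y"
  by (rule frob_pow_unique) (simp add: power_mult_distrib frob_pow_char)

lemma frob_pow_sum:
  "frob_pow i (sum f S :: 'a::perfect_ring_prime_char) = (\<Sum>s\<in>S. frob_pow i (f s))"
  by (induction S rule: infinite_finite_induct) (auto simp: frob_pow_add)

lemma frob_pow_frob_pow:
  "frob_pow i (frob_pow j (x :: 'a::perfect_ring_prime_char)) = frob_pow (i + j) x"
proof -
  define n where "n = nat (\<bar>i\<bar> + \<bar>j\<bar>)"
  define m where "m = nat (int n + i)"
  have nonneg: "0 \<le> int n + i" "0 \<le> int m + j" "0 \<le> int n + (i + j)"
    and m: "nat (int m + j) = nat (int n + (i + j))"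
    by (auto simp: n_def m_def)
  have "(frob_pow i (frob_pow j x)) ^ (CHAR('a) ^ n) = (frob_pow j x) ^ (CHAR('a) ^ m)"
    using frob_pow_char[OF nonneg(1)] by (simp add: m_def)
  also have "\<dots> = (frob_pow (i + j) x) ^ (CHAR('a) ^ n)"
    by (simp only: frob_pow_char[OF nonneg(2)] frob_pow_char[OF nonneg(3)] m)
  finally have "(frob_pow i (frob_pow j x)) ^ (CHAR('a) ^ n)
      = (frob_pow (i + j) x) ^ (CHAR('a) ^ n)" .
  then show ?thesis by (rule frob_pow_inj)
qed


section \<open>The ring of twisted Laurent series in \<open>\<tau>\<^sup>-\<^sup>1\<close>\<close>

text \<open>
  The series \<open>\<Sum>\<^sub>i x\<^sub>i \<tau>\<^sup>i\<close> is represented by its coefficient function; the coefficient \<open>x\<^sub>i\<close>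
  vanishes for all sufficiently large \<open>i\<close>.
\<close>

typedef (overloaded) 'a twisted_laurent = "{f :: int \<Rightarrow> 'a::zero. \<exists>N. \<forall>i>N. f i = 0}"
  morphisms tl_coeff Abs_twisted_laurent
  by (rule exI[of _ "\<lambda>_. 0"]) simp

setup_lifting type_definition_twisted_laurent

lemma twisted_laurent_eqI: "(\<And>i. tl_coeff x i = tl_coeff y i) \<Longrightarrow> x = y"
  by (simp add: tl_coeff_inject[symmetric] fun_eq_iff)

lemma tl_coeff_bounded: "\<exists>N. \<forall>i>N. tl_coeff x i = 0"
  by transfer

text \<open>
  Multiplication is determined by \<open>\<tau>\<^sup>i x = x\<^bsup>p\<^sup>i\<^esup> \<tau>\<^sup>i\<close>, hence
  \<open>x\<^sub>i \<tau>\<^sup>i \<cdot> y\<^sub>j \<tau>\<^sup>j = x\<^sub>i y\<^sub>j\<^bsup>p\<^sup>i\<^esup> \<tau>\<^bsup>i+j\<^esup>\<close>.  The index set below is finite, since both coefficient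
  functions are bounded above.
\<close>

definition twisted_conv ::
  "(int \<Rightarrow> 'a::perfect_ring_prime_char) \<Rightarrow> (int \<Rightarrow> 'a) \<Rightarrow> int \<Rightarrow> 'a" where
  "twisted_conv f g n =
    (\<Sum>i | f i \<noteq> 0 \<and> g (n - i) \<noteq> 0. f i * frob_pow i (g (n - i)))"

lemma twisted_conv_eq:
  assumes "\<And>i. i > N \<Longrightarrow> f i = 0" "\<And>i. i > M \<Longrightarrow> g i = 0" "a \<le> n - M" "N \<le> b"
  shows "twisted_conv f g n = (\<Sum>i\<in>{a..b}. f i * frob_pow i (g (n - i)))"
  unfolding twisted_conv_def
proof (rule sum.mono_neutral_left)
  show "{i. f i \<noteq> 0 \<and> g (n - i) \<noteq> 0} \<subseteq> {a..b}"
  proof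
    fix i assume "i \<in> {i. f i \<noteq> 0 \<and> g (n - i) \<noteq> 0}"
    then have "\<not> N < i" "\<not> M < n - i" using assms(1)[of i] assms(2)[of "n - i"] by blast+
    then show "i \<in> {a..b}" using assms(3,4) by simp
  qed
qed auto

lemma twisted_conv_bounded:
  assumes "\<And>i. i > N \<Longrightarrow> f i = 0" "\<And>i. i > M \<Longrightarrow> g i = 0" "n > N + M"
  shows "twisted_conv f g n = 0"
  using twisted_conv_eq[of N f M g "n - M" n N] assms by simp

instantiation twisted_laurent :: (zero) zero
begin
lift_definition zero_twisted_laurent :: "'a twisted_laurent" is "\<lambda>_. 0" by simp
instance ..
end

instantiation twisted_laurent :: (zero_neq_one) one
begin
lift_definition one_twisted_laurent :: "'a twisted_laurent" is "\<lambda>i. if i = 0 then 1 else 0"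
  by (rule exI[of _ 0]) simp
instance ..
end

instantiation twisted_laurent :: (ab_group_add) ab_group_add
begin

lift_definition plus_twisted_laurent ::
  "'a twisted_laurent \<Rightarrow> 'a twisted_laurent \<Rightarrow> 'a twisted_laurent" is "\<lambda>f g i. f i + g i"
proof -
  fix f g :: "int \<Rightarrow> 'a"
  assume "\<exists>N. \<forall>i>N. f i = 0" "\<exists>N. \<forall>i>N. g i = 0"
  then obtain N M where "\<forall>i>N. f i = 0" "\<forall>i>M. g i = 0" by blast
  then show "\<exists>N. \<forall>i>N. f i + g i = 0" by (intro exI[of _ "max N M"]) simp
qed

lift_definition uminus_twisted_laurent :: "'a twisted_laurent \<Rightarrow> 'a twisted_laurent"
  is "\<lambda>f i. - f i" by simp

lift_definition minus_twisted_laurent ::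
  "'a twisted_laurent \<Rightarrow> 'a twisted_laurent \<Rightarrow> 'a twisted_laurent" is "\<lambda>f g i. f i - g i"
proof -
  fix f g :: "int \<Rightarrow> 'a"
  assume "\<exists>N. \<forall>i>N. f i = 0" "\<exists>N. \<forall>i>N. g i = 0"
  then obtain N M where "\<forall>i>N. f i = 0" "\<forall>i>M. g i = 0" by blast
  then show "\<exists>N. \<forall>i>N. f i - g i = 0" by (intro exI[of _ "max N M"]) simp
qed

instance by standard (transfer; simp add: fun_eq_iff algebra_simps)+

end

instantiation twisted_laurent :: (perfect_ring_prime_char) ring_1
begin

lift_definition times_twisted_laurent ::
  "'a twisted_laurent \<Rightarrow> 'a twisted_laurent \<Rightarrow> 'a twisted_laurent" is twisted_conv
proof -
  fix f g :: "int \<Rightarrow> 'a"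
  assume "\<exists>N. \<forall>i>N. f i = 0" "\<exists>N. \<forall>i>N. g i = 0"
  then obtain N M where f: "\<And>i. i > N \<Longrightarrow> f i = 0" and g: "\<And>i. i > M \<Longrightarrow> g i = 0" by blast
  show "\<exists>N. \<forall>i>N. twisted_conv f g i = 0"
    using twisted_conv_bounded[OF f g] by (intro exI[of _ "N + M"]) simp
qed

instance
proof
  fix x y z :: "'a twisted_laurent"
  show "x * y * z = x * (y * z)"
  proof transfer
    fix f g h :: "int \<Rightarrow> 'a"
    assume "\<exists>N. \<forall>i>N. f i = 0" "\<exists>N. \<forall>i>N. g i = 0" "\<exists>N. \<forall>i>N. h i = 0"
    then obtain N M L where f: "\<And>i. i > N \<Longrightarrow> f i = 0" and g: "\<And>i. i > M \<Longrightarrow> g i = 0"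
      and h: "\<And>i. i > L \<Longrightarrow> h i = 0" by blast
    show "twisted_conv (twisted_conv f g) h = twisted_conv f (twisted_conv g h)"
    proof
      fix n
      define a where "a = n - L"
      have fg: "twisted_conv f g i = 0" if "i > N + M" for i
        using twisted_conv_bounded[OF f g that] .
      have gh: "twisted_conv g h i = 0" if "i > M + L" for i
        using twisted_conv_bounded[OF g h that] .
      have "twisted_conv (twisted_conv f g) h n
          = (\<Sum>i\<in>{a..N + M}. twisted_conv f g i * frob_pow i (h (n - i)))"
        by (rule twisted_conv_eq[OF fg h]) (auto simp: a_def)
      also have "\<dots> = (\<Sum>i\<in>{a..N + M}. \<Sum>j\<in>{a - M..N}.
            f j * frob_pow j (g (i - j)) * frob_pow i (h (n - i)))"
      proof (rule sum.cong[OF refl])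
        fix i assume i: "i \<in> {a..N + M}"
        have "twisted_conv f g i = (\<Sum>j\<in>{a - M..N}. f j * frob_pow j (g (i - j)))"
          by (rule twisted_conv_eq[OF f g]) (use i in auto)
        then show "twisted_conv f g i * frob_pow i (h (n - i)) = (\<Sum>j\<in>{a - M..N}.
            f j * frob_pow j (g (i - j)) * frob_pow i (h (n - i)))"
          by (simp add: sum_distrib_right)
      qed
      also have "\<dots> = (\<Sum>j\<in>{a - M..N}. \<Sum>i\<in>{a..N + M}.
            f j * frob_pow j (g (i - j)) * frob_pow i (h (n - i)))"
        by (rule sum.swap)
      also have "\<dots> = (\<Sum>j\<in>{a - M..N}. f j * frob_pow j (twisted_conv g h (n - j)))"
      proof (rule sum.cong[OF refl])
        fix j assume j: "j \<in> {a - M..N}"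
        have "twisted_conv g h (n - j)
            = (\<Sum>l\<in>{a - j..N + M - j}. g l * frob_pow l (h (n - j - l)))"
          by (rule twisted_conv_eq[OF g h]) (use j in \<open>auto simp: a_def\<close>)
        also have "\<dots> = (\<Sum>i\<in>{a..N + M}. g (i - j) * frob_pow (i - j) (h (n - i)))"
          by (rule sum.reindex_bij_witness[of _ "\<lambda>i. i - j" "\<lambda>l. l + j"]) (auto simp: algebra_simps)
        finally show "(\<Sum>i\<in>{a..N + M}. f j * frob_pow j (g (i - j)) * frob_pow i (h (n - i)))
            = f j * frob_pow j (twisted_conv g h (n - j))"
          by (simp add: frob_pow_sum frob_pow_mult frob_pow_frob_pow sum_distrib_left mult.assoc)
      qed
      also have "\<dots> = twisted_conv f (twisted_conv g h) n"
        by (rule twisted_conv_eq[symmetric, OF f gh]) (auto simp: a_def)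
      finally show "twisted_conv (twisted_conv f g) h n = twisted_conv f (twisted_conv g h) n" .
    qed
  qed
  show "(x + y) * z = x * z + y * z"
  proof transfer
    fix f g h :: "int \<Rightarrow> 'a"
    assume "\<exists>N. \<forall>i>N. f i = 0" "\<exists>N. \<forall>i>N. g i = 0" "\<exists>N. \<forall>i>N. h i = 0"
    then obtain N M L where *: "\<forall>i>N. f i = 0" "\<forall>i>M. g i = 0" "\<forall>i>L. h i = 0" by blast
    let ?N = "max N M"
    show "twisted_conv (\<lambda>i. f i + g i) h = (\<lambda>i. twisted_conv f h i + twisted_conv g h i)"
    proof
      fix n
      show "twisted_conv (\<lambda>i. f i + g i) h n = twisted_conv f h n + twisted_conv g h n"
        using * by (simp add: twisted_conv_eq[of ?N _ L _ "n - L" n ?N] sum.distrib algebra_simps)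
    qed
  qed
  show "x * (y + z) = x * y + x * z"
  proof transfer
    fix f g h :: "int \<Rightarrow> 'a"
    assume "\<exists>N. \<forall>i>N. f i = 0" "\<exists>N. \<forall>i>N. g i = 0" "\<exists>N. \<forall>i>N. h i = 0"
    then obtain N M L where *: "\<forall>i>N. f i = 0" "\<forall>i>M. g i = 0" "\<forall>i>L. h i = 0" by blast
    let ?M = "max M L"
    show "twisted_conv f (\<lambda>i. g i + h i) = (\<lambda>i. twisted_conv f g i + twisted_conv f h i)"
    proof
      fix n
      show "twisted_conv f (\<lambda>i. g i + h i) n = twisted_conv f g n + twisted_conv f h n"
        using * by (simp add: twisted_conv_eq[of N _ ?M _ "n - ?M" n N] sum.distrib
            frob_pow_add algebra_simps)
    qed
  qed
  show "1 * x = x"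
  proof transfer
    fix f :: "int \<Rightarrow> 'a"
    show "twisted_conv (\<lambda>i. if i = 0 then 1 else 0) f = f"
    proof
      fix n
      have "{i. (if i = 0 then 1 else 0 :: 'a) \<noteq> 0 \<and> f (n - i) \<noteq> 0}
          = (if f n \<noteq> 0 then {0} else {})" by auto
      then show "twisted_conv (\<lambda>i. if i = 0 then 1 else 0) f n = f n"
        by (simp add: twisted_conv_def)
    qed
  qed
  show "x * 1 = x"
  proof transfer
    fix f :: "int \<Rightarrow> 'a"
    show "twisted_conv f (\<lambda>i. if i = 0 then 1 else 0) = f"
    proof
      fix n
      have "{i. f i \<noteq> 0 \<and> (if n - i = 0 then 1 else 0 :: 'a) \<noteq> 0}
          = (if f n \<noteq> 0 then {n} else {})" by auto
      then show "twisted_conv f (\<lambda>i. if i = 0 then 1 else 0) n = f n"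
        by (simp add: twisted_conv_def)
    qed
  qed
  show "(0 :: 'a twisted_laurent) \<noteq> 1"
    by transfer (auto simp: fun_eq_iff)
qed

end

text \<open>For subsets \<open>R\<close> of the coefficients: \<open>R[\<tau>]\<close> and \<open>R[[\<tau>\<^sup>-\<^sup>1]]\<close>.\<close>

definition twisted_polys :: "'a::zero set \<Rightarrow> 'a twisted_laurent set" where
  "twisted_polys R = {x. (\<forall>i. tl_coeff x i \<in> R) \<and> (\<forall>i<0. tl_coeff x i = 0)}"

definition twisted_power_series :: "'a::zero set \<Rightarrow> 'a twisted_laurent set" where
  "twisted_power_series R = {x. (\<forall>i. tl_coeff x i \<in> R) \<and> (\<forall>i>0. tl_coeff x i = 0)}"

lift_definition tl_const :: "'a::zero \<Rightarrow> 'a twisted_laurent" is "\<lambda>c i. if i = 0 then c else 0"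
  by (rule exI[of _ 0]) simp

text \<open>The junk value for \<open>x = 0\<close> is \<open>0\<close>.\<close>

definition tl_lead_coeff :: "'a::zero twisted_laurent \<Rightarrow> 'a" where
  "tl_lead_coeff x = tl_coeff x (GREATEST i. tl_coeff x i \<noteq> 0)"

text \<open>Application of a map \<open>h\<close> with \<open>h 0 = 0\<close> to all coefficients.\<close>

lift_definition tl_map :: "('a::zero \<Rightarrow> 'b::zero) \<Rightarrow> 'a twisted_laurent \<Rightarrow> 'b twisted_laurent"
  is "\<lambda>h f i. if f i = 0 then 0 else h (f i)"
  by auto


section \<open>Valuations and local fields\<close>

definition subfield_of_type :: "'a::field set \<Rightarrow> bool" where
  "subfield_of_type K \<longleftrightarrow> 1 \<in> K \<and> (\<forall>x\<in>K. \<forall>y\<in>K. x - y \<in> K \<and> x * y \<in> K) \<and> (\<forall>x\<in>K. inverse x \<in> K)"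

definition valuation_on :: "'a::field set \<Rightarrow> ('a \<Rightarrow> ereal) \<Rightarrow> bool" where
  "valuation_on K v \<longleftrightarrow>
    (\<forall>x\<in>K. v x \<noteq> - \<infinity> \<and> (v x = \<infinity> \<longleftrightarrow> x = 0)) \<and>
    (\<forall>x\<in>K. \<forall>y\<in>K. v (x * y) = v x + v y \<and> min (v x) (v y) \<le> v (x + y))"

definition normalized_valuation_on :: "'a::field set \<Rightarrow> ('a \<Rightarrow> ereal) \<Rightarrow> bool" where
  "normalized_valuation_on K v \<longleftrightarrow>
    valuation_on K v \<and> v ` (K - {0}) = range (\<lambda>n::int. ereal (of_int n))"

definition valuation_ring :: "'a::field set \<Rightarrow> ('a \<Rightarrow> ereal) \<Rightarrow> 'a set" where
  "valuation_ring K v = {x\<in>K. 0 \<le> v x}"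

definition maximal_ideal :: "'a::field set \<Rightarrow> ('a \<Rightarrow> ereal) \<Rightarrow> 'a set" where
  "maximal_ideal K v = {x\<in>K. 0 < v x}"

definition residue_class :: "'a::field set \<Rightarrow> ('a \<Rightarrow> ereal) \<Rightarrow> 'a \<Rightarrow> 'a set" where
  "residue_class K v x = {y. y - x \<in> maximal_ideal K v}"

definition residue_field :: "'a::field set \<Rightarrow> ('a \<Rightarrow> ereal) \<Rightarrow> 'a set set" where
  "residue_field K v = residue_class K v ` valuation_ring K v"

definition valuation_complete :: "'a::field set \<Rightarrow> ('a \<Rightarrow> ereal) \<Rightarrow> bool" where
  "valuation_complete K v \<longleftrightarrow>
    (\<forall>X::nat \<Rightarrow> 'a. (\<forall>n. X n \<in> K) \<and>
        (\<forall>r::real. \<exists>N. \<forall>m\<ge>N. \<forall>n\<ge>N. ereal r < v (X m - X n)) \<longrightarrow>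
      (\<exists>L\<in>K. \<forall>r::real. \<exists>N. \<forall>n\<ge>N. ereal r < v (X n - L)))"

definition local_field :: "'a::field set \<Rightarrow> ('a \<Rightarrow> ereal) \<Rightarrow> bool" where
  "local_field K v \<longleftrightarrow>
    subfield_of_type K \<and> normalized_valuation_on K v \<and> valuation_complete K v \<and>
    finite (residue_field K v)"

text \<open>
  A local field \<open>K\<close> of characteristic \<open>p\<close> is given as a subfield of its perfection.  The latter
  is the whole type, which is perfect by its type class and purely inseparable over \<open>K\<close>.
  A valuation \<open>v\<close> on the whole type whose restriction to \<open>K\<close> is normalized is the (unique)
  extension of the normalized valuation of \<open>K\<close> to the perfection.
\<close>

definition local_field_in_perfection ::
  "'a::{field, perfect_ring_prime_char} set \<Rightarrow> ('a \<Rightarrow> ereal) \<Rightarrow> bool" where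
  "local_field_in_perfection K v \<longleftrightarrow>
    local_field K v \<and> valuation_on UNIV v \<and> (\<forall>x. \<exists>n. x ^ (CHAR('a) ^ n) \<in> K)"

text \<open>A ring homomorphism from the residue field to the valuation ring splitting the reduction.\<close>

definition residue_section :: "'a::field set \<Rightarrow> ('a \<Rightarrow> ereal) \<Rightarrow> ('a set \<Rightarrow> 'a) \<Rightarrow> bool" where
  "residue_section K v s \<longleftrightarrow>
    (\<forall>c\<in>residue_field K v. s c \<in> valuation_ring K v \<and> residue_class K v (s c) = c) \<and>
    s (residue_class K v 1) = 1 \<and>
    (\<forall>x\<in>valuation_ring K v. \<forall>y\<in>valuation_ring K v.
      s (residue_class K v (x + y)) = s (residue_class K v x) + s (residue_class K v y) \<and>
      s (residue_class K v (x * y)) = s (residue_class K v x) * s (residue_class K v y))"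

definition tl_val :: "('a::zero \<Rightarrow> ereal) \<Rightarrow> 'a twisted_laurent \<Rightarrow> ereal" where
  "tl_val v x = (INF i. v (tl_coeff x i))"


section \<open>Global function fields and admissible coefficient rings\<close>

definition prime_subfield :: "'f::field_prime_char set" where
  "prime_subfield = range of_nat"

definition prime_rational_functions :: "'f::field_prime_char \<Rightarrow> 'f set" where
  "prime_rational_functions t =
    {poly q t / poly r t | q r. set (coeffs q) \<subseteq> prime_subfield \<and> set (coeffs r) \<subseteq> prime_subfield \<and>
      poly r t \<noteq> 0}"

text \<open>A finite extension of \<open>\<bbbF>\<^sub>p(t)\<close> for some \<open>t\<close> transcendental over the prime field.\<close>

definition global_function_field :: "'f::field_prime_char itself \<Rightarrow> bool" where
  "global_function_field _ \<longleftrightarrow>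
    (\<exists>t::'f. (\<forall>q. set (coeffs q) \<subseteq> prime_subfield \<and> poly q t = 0 \<longrightarrow> q = 0) \<and>
      (\<exists>B. finite B \<and> (\<forall>x. \<exists>c. (\<forall>b\<in>B. c b \<in> prime_rational_functions t) \<and> x = (\<Sum>b\<in>B. c b * b))))"

text \<open>
  Every nontrivial valuation on a global function field is discrete, so its places correspond
  bijectively to its normalized valuations.
\<close>

definition places :: "('f::field \<Rightarrow> ereal) set" where
  "places = {w. normalized_valuation_on UNIV w}"

definition regular_outside :: "('f::field \<Rightarrow> ereal) \<Rightarrow> 'f set" where
  "regular_outside infty = {a. \<forall>w\<in>places - {infty}. 0 \<le> w a}"


section \<open>Drinfeld modules of good reduction\<close>

definition ring_hom_on :: "'f::ring_1 set \<Rightarrow> ('f \<Rightarrow> 'b::ring_1) \<Rightarrow> bool" where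
  "ring_hom_on A \<psi> \<longleftrightarrow> \<psi> 1 = 1 \<and>
    (\<forall>a\<in>A. \<forall>b\<in>A. \<psi> (a + b) = \<psi> a + \<psi> b \<and> \<psi> (a * b) = \<psi> a * \<psi> b)"

definition drinfeld_good_reduction ::
  "'f::field set \<Rightarrow> 'a::{field, perfect_ring_prime_char} set \<Rightarrow> ('f \<Rightarrow> 'a twisted_laurent) \<Rightarrow> bool"
where
  "drinfeld_good_reduction A R \<psi> \<longleftrightarrow>
    ring_hom_on A \<psi> \<and> \<psi> ` A \<subseteq> twisted_polys R \<and> \<not> \<psi> ` A \<subseteq> tl_const ` R \<and>
    (\<forall>a\<in>A. a \<noteq> 0 \<longrightarrow> (\<exists>u\<in>R. tl_lead_coeff (\<psi> a) \<in> R \<and> tl_lead_coeff (\<psi> a) * u = 1))"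

text \<open>The reduction of a Drinfeld module, viewed over the valuation ring via the section \<open>s\<close>.\<close>

definition lifted_reduction ::
  "'a::field set \<Rightarrow> ('a \<Rightarrow> ereal) \<Rightarrow> ('a set \<Rightarrow> 'a) \<Rightarrow> ('f \<Rightarrow> 'a twisted_laurent) \<Rightarrow> 'f \<Rightarrow> 'a twisted_laurent"
where
  "lifted_reduction K v s \<psi> a = tl_map (\<lambda>c. s (residue_class K v c)) (\<psi> a)"

definition congruent_one :: "'a::field set \<Rightarrow> ('a \<Rightarrow> ereal) \<Rightarrow> 'a twisted_laurent \<Rightarrow> bool" where
  "congruent_one K v x \<longleftrightarrow>
    tl_coeff x 0 - 1 \<in> maximal_ideal K v \<and> (\<forall>j<0. tl_coeff x j \<in> maximal_ideal K v)"

end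

theory Submission
  imports Defs
begin

text \<open>
  Everything is governed by a single element \<open>a \<in> A\<close> for which \<open>\<psi>\<^sub>a\<close> has positive degree \<open>d\<close> in
  \<open>\<tau>\<close>. Write \<open>\<psi>\<^sub>a = \<Sum>\<^sub>i a\<^sub>i \<tau>\<^sup>i\<close> and \<open>\<phi>\<^sub>a = \<Sum>\<^sub>i b\<^sub>i \<tau>\<^sup>i\<close>; both leading coefficients \<open>a\<^sub>d\<close>, \<open>b\<^sub>d\<close> are
  units, and \<open>a\<^sub>i \<equiv> b\<^sub>i\<close> modulo the maximal ideal.

  Rigidity (\<open>intertwiner_rigid\<close>): if \<open>\<psi>\<^sub>a D = D \<phi>\<^sub>a\<close> and all coefficients of \<open>D\<close> have positive
  valuation, then \<open>D = 0\<close>. Indeed, comparing the highest coefficients shows that the top coefficient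
  \<open>c\<close> of a nonzero \<open>D\<close> satisfies \<open>p\<^sup>d v(c) = v(c)\<close>, whereas \<open>0 < v(c) < \<infinity>\<close> and \<open>p\<^sup>d \<ge> 2\<close>. This has
  two consequences. Two solutions \<open>x\<close>, \<open>x'\<close> congruent to \<open>1\<close> differ by such a \<open>D\<close>, so they agree.
  And a solution \<open>x\<close> of the one equation for \<open>a\<close> solves the equation for every \<open>b \<in> A\<close>: as \<open>\<psi>\<close> and
  \<open>\<phi>\<close> have commutative images, \<open>D = \<psi>\<^sub>b x - x \<phi>\<^sub>b\<close> again satisfies \<open>\<psi>\<^sub>a D = D \<phi>\<^sub>a\<close>, and \<open>D\<close>
  vanishes modulo the maximal ideal because there \<open>x\<close> is \<open>1\<close> and \<open>\<psi>\<^sub>b\<close> is \<open>\<phi>\<^sub>b\<close>.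

  Existence (\<open>intertwiner_exists\<close>): the coefficient of \<open>\<tau>\<^bsup>d-n\<^esup>\<close> in \<open>\<psi>\<^sub>a x = x \<phi>\<^sub>a\<close> reads
  \<open>a\<^sub>d z\<^bsup>q\<^esup> - b z = c\<close> with \<open>z = x\<^sub>-\<^sub>n\<close>, \<open>q = p\<^sup>d\<close>, a unit \<open>b = b\<^sub>d\<^bsup>p^(-n)\<^esup>\<close>, and \<open>c\<close> depending only on
  \<open>x\<^sub>0, \<dots>, x\<^sub>-\<^sub>n\<^sub>+\<^sub>1\<close>. Here \<open>b\<close> lies in \<open>K\<close>, since the residue field is finite, hence perfect, and thus
  its lift contains the \<open>p\<close>-th roots of its elements. After subtraction of the expected value
  (\<open>1\<close> for \<open>n = 0\<close>, otherwise \<open>0\<close>) from \<open>z\<close>, the right-hand side is small and the equation, which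
  is additive in \<open>z\<close>, is solved in the complete field \<open>K\<close> by iterating \<open>z \<mapsto> (a\<^sub>d z\<^bsup>q\<^esup> - c) / b\<close>
  (\<open>additive_equation_solvable\<close>); the solution is at least as small as \<open>c\<close>. Running this recursion
  inside the ideal of elements of positive valuation at least \<open>w\<close> gives \<open>x\<close> and \<open>v(x - 1) \<ge> w\<close>
  simultaneously.

  Finally \<open>x\<close> has a unit as its constant coefficient and so is invertible among the integral power
  series in \<open>\<tau>\<^sup>-\<^sup>1\<close> (\<open>inverse_exists\<close>), and \<open>x\<^sup>-\<^sup>1 - 1 = - (x - 1) x\<^sup>-\<^sup>1\<close> inherits the bound from
  \<open>x - 1\<close>.
\<close>

section \<open>Coefficients of twisted Laurent series\<close>

lemma frob_pow_uminus: "frob_pow i (- x :: 'a::perfect_ring_prime_char) = - frob_pow i x"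
  using frob_pow_add[of i x "- x"] by (simp add: eq_neg_iff_add_eq_0 add.commute)

lemma frob_pow_diff:
  "frob_pow i (x - y :: 'a::perfect_ring_prime_char) = frob_pow i x - frob_pow i y"
  using frob_pow_add[of i x "- y"] by (simp add: frob_pow_uminus)

lemma tl_coeff_simps [simp]:
  "tl_coeff 0 i = 0" "tl_coeff 1 i = (if i = 0 then 1 else 0)"
  "tl_coeff (x + y) i = tl_coeff x i + tl_coeff y i"
  "tl_coeff (x - y) i = tl_coeff x i - tl_coeff y i"
  "tl_coeff (- x) i = - tl_coeff x i"
  "tl_coeff (tl_const c) i = (if i = 0 then c else 0)"
  by (transfer; simp)+

lemma tl_coeff_tl_map: "h 0 = 0 \<Longrightarrow> tl_coeff (tl_map h x) i = h (tl_coeff x i)"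
  by transfer auto

lemma tl_coeff_mult:
  assumes "\<And>i. i > N \<Longrightarrow> tl_coeff x i = 0" "\<And>i. i > M \<Longrightarrow> tl_coeff y i = 0"
    "a \<le> n - M" "N \<le> b"
  shows "tl_coeff (x * y) n = (\<Sum>i\<in>{a..b}. tl_coeff x i * frob_pow i (tl_coeff y (n - i)))"
  unfolding times_twisted_laurent.rep_eq by (rule twisted_conv_eq[OF assms])

lemma tl_coeff_mult_top:
  assumes "\<And>i. i > N \<Longrightarrow> tl_coeff x i = 0" "\<And>i. i > M \<Longrightarrow> tl_coeff y i = 0"
  shows "tl_coeff (x * y) (N + M) = tl_coeff x N * frob_pow N (tl_coeff y M)"
  using tl_coeff_mult[of N x M y N "N + M" N, OF assms] by simp

lemma tl_coeff_mult_eq_0: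
  assumes "\<And>i. i > N \<Longrightarrow> tl_coeff x i = 0" "\<And>i. i > M \<Longrightarrow> tl_coeff y i = 0" "n > N + M"
  shows "tl_coeff (x * y) n = 0"
  using tl_coeff_mult[of N x M y "n - M" n N, OF assms(1,2)] assms(3) by simp

text \<open>
  The two products below are indexed by the distance \<open>n\<close> from the top degree. In this form the
  coefficient number \<open>n\<close> of a product involves only the first \<open>n + 1\<close> coefficients of the power
  series in \<open>\<tau>\<^sup>-\<^sup>1\<close>, which is what allows a power series to be constructed recursively.
\<close>

lemma tl_coeff_mult_series_right:
  assumes "\<And>i. i > d \<Longrightarrow> tl_coeff x i = 0" "\<And>i. i > 0 \<Longrightarrow> tl_coeff y i = 0"
  shows "tl_coeff (x * y) (d - int n) =
    (\<Sum>k\<le>n. tl_coeff x (d - int n + int k) * frob_pow (d - int n + int k) (tl_coeff y (- int k)))"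
proof -
  have "tl_coeff (x * y) (d - int n) = (\<Sum>i\<in>{d - int n..d}.
      tl_coeff x i * frob_pow i (tl_coeff y (d - int n - i)))"
    by (rule tl_coeff_mult[OF assms]) auto
  also have "\<dots> = (\<Sum>k\<le>n. tl_coeff x (d - int n + int k) *
      frob_pow (d - int n + int k) (tl_coeff y (- int k)))"
    by (rule sum.reindex_bij_witness
        [of _ "\<lambda>k. d - int n + int k" "\<lambda>i. nat (i - d + int n)"])
      (auto simp: algebra_simps)
  finally show ?thesis .
qed

lemma tl_coeff_mult_series_left:
  assumes "\<And>i. i > 0 \<Longrightarrow> tl_coeff x i = 0" "\<And>i. i > d \<Longrightarrow> tl_coeff y i = 0"
  shows "tl_coeff (x * y) (d - int n) =
    (\<Sum>k\<le>n. tl_coeff x (- int k) * frob_pow (- int k) (tl_coeff y (d - int n + int k)))"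
proof -
  have "tl_coeff (x * y) (d - int n) = (\<Sum>i\<in>{- int n..0}.
      tl_coeff x i * frob_pow i (tl_coeff y (d - int n - i)))"
    by (rule tl_coeff_mult[OF assms]) auto
  also have "\<dots> = (\<Sum>k\<le>n. tl_coeff x (- int k) *
      frob_pow (- int k) (tl_coeff y (d - int n + int k)))"
    by (rule sum.reindex_bij_witness[of _ "\<lambda>k. - int k" "\<lambda>i. nat (- i)"]) auto
  finally show ?thesis .
qed

lift_definition series_in_inverse_tau :: "(nat \<Rightarrow> 'a::zero) \<Rightarrow> 'a twisted_laurent"
  is "\<lambda>f i. if i \<le> 0 then f (nat (- i)) else 0"
  by (rule exI[of _ 0]) simp

lemma tl_coeff_series_in_inverse_tau [simp]:
  "tl_coeff (series_in_inverse_tau f) i = (if i \<le> 0 then f (nat (- i)) else 0)"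
  by transfer simp

lemma obtain_tl_degree:
  assumes "x \<noteq> 0"
  obtains d where "tl_coeff x d \<noteq> 0" "\<And>i. i > d \<Longrightarrow> tl_coeff x i = 0"
proof -
  obtain i0 where i0: "tl_coeff x i0 \<noteq> 0"
    using assms twisted_laurent_eqI[of x 0] by auto
  obtain N where N: "\<And>i. i > N \<Longrightarrow> tl_coeff x i = 0"
    using tl_coeff_bounded by blast
  define S where "S = {i\<in>{i0..N}. tl_coeff x i \<noteq> 0}"
  have "finite S" by (rule finite_subset[of _ "{i0..N}"]) (auto simp: S_def)
  have "i0 \<in> S" using i0 N[of i0] by (force simp: S_def)
  show thesis
  proof
    have "Max S \<in> S" using \<open>finite S\<close> \<open>i0 \<in> S\<close> by (intro Max_in) auto
    then show "tl_coeff x (Max S) \<noteq> 0" by (simp add: S_def)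
    have "i0 \<le> Max S" using \<open>finite S\<close> \<open>i0 \<in> S\<close> by simp
    fix i assume "i > Max S"
    then have "i \<notin> S" using \<open>finite S\<close> by (meson Max_ge leD)
    with \<open>i > Max S\<close> \<open>i0 \<le> Max S\<close> N[of i] show "tl_coeff x i = 0" by (force simp: S_def)
  qed
qed

lemma tl_lead_coeff_eq:
  assumes "tl_coeff x d \<noteq> 0" "\<And>i. i > d \<Longrightarrow> tl_coeff x i = 0"
  shows "tl_lead_coeff x = tl_coeff x d"
proof -
  have "(GREATEST i. tl_coeff x i \<noteq> 0) = d"
    by (rule Greatest_equality) (use assms in \<open>auto simp: not_less[symmetric]\<close>)
  then show ?thesis by (simp add: tl_lead_coeff_def)
qed

text \<open>
  Multiplicativity needs nonnegative exponents: \<open>h\<close> then commutes with the Frobenius powers in the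
  product because these are ordinary powers, whereas \<open>R\<close> need not contain \<open>p\<close>-th roots.
\<close>

lemma tl_map_mult:
  fixes h :: "'a::perfect_ring_prime_char \<Rightarrow> 'a"
  assumes R: "0 \<in> R" "1 \<in> R" "\<And>a b. a \<in> R \<Longrightarrow> b \<in> R \<Longrightarrow> a + b \<in> R \<and> a * b \<in> R"
    and h: "h 0 = 0" "h 1 = 1"
      "\<And>a b. a \<in> R \<Longrightarrow> b \<in> R \<Longrightarrow> h (a + b) = h a + h b \<and> h (a * b) = h a * h b"
    and xy: "x \<in> twisted_polys R" "y \<in> twisted_polys R"
  shows "tl_map h (x * y) = tl_map h x * tl_map h y"
proof (rule twisted_laurent_eqI)
  fix n
  obtain N M where N: "\<And>i. i > N \<Longrightarrow> tl_coeff x i = 0" and M: "\<And>i. i > M \<Longrightarrow> tl_coeff y i = 0"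
    using tl_coeff_bounded by metis
  have pow: "a ^ m \<in> R \<and> h (a ^ m) = h a ^ m" if "a \<in> R" for a m
    by (induction m) (use R h that in auto)
  have frob: "frob_pow i a \<in> R \<and> h (frob_pow i a) = frob_pow i (h a)" if "a \<in> R" "0 \<le> i" for a i
    using that pow by (simp add: frob_pow_def)
  have sum: "sum f S \<in> R \<and> h (sum f S) = (\<Sum>i\<in>S. h (f i))" if "\<And>i. i \<in> S \<Longrightarrow> f i \<in> R"
    for f and S :: "int set"
    using that by (induction S rule: infinite_finite_induct) (use R h in auto)
  have summand: "tl_coeff x i * frob_pow i (tl_coeff y j) \<in> R \<and>
      h (tl_coeff x i * frob_pow i (tl_coeff y j)) = h (tl_coeff x i) * frob_pow i (h (tl_coeff y j))"
    for i j
    using xy frob[of "tl_coeff y j" i] R h by (cases "i < 0") (auto simp: twisted_polys_def)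
  have "h (tl_coeff (x * y) n) = h (\<Sum>i\<in>{n - M..N}. tl_coeff x i * frob_pow i (tl_coeff y (n - i)))"
    by (subst tl_coeff_mult[where N = N and M = M and a = "n - M" and b = N]) (auto simp: N M)
  also have "\<dots> = (\<Sum>i\<in>{n - M..N}. h (tl_coeff x i) * frob_pow i (h (tl_coeff y (n - i))))"
    using summand sum by simp
  also have "\<dots> = tl_coeff (tl_map h x * tl_map h y) n"
    using tl_coeff_mult[of N "tl_map h x" M "tl_map h y" "n - M" n N, symmetric]
    by (simp add: tl_coeff_tl_map h N M)
  finally show "tl_coeff (tl_map h (x * y)) n = tl_coeff (tl_map h x * tl_map h y) n"
    by (simp add: tl_coeff_tl_map h)
qed

section \<open>Valuations and Frobenius powers\<close>

locale valued_perfect_field =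
  fixes v :: "'a::{field, perfect_ring_prime_char} \<Rightarrow> ereal"
  assumes valuation: "valuation_on UNIV v"
begin

lemma val_eq_infinity [simp]: "v x = \<infinity> \<longleftrightarrow> x = 0"
  and val_not_minus_infinity [simp]: "v x \<noteq> - \<infinity>"
  and val_mult: "v (x * y) = v x + v y"
  and val_add: "min (v x) (v y) \<le> v (x + y)"
  using valuation by (auto simp: valuation_on_def)

lemma val_0 [simp]: "v 0 = \<infinity>"
  by simp

lemma val_1 [simp]: "v 1 = 0"
proof -
  have "v 1 = v 1 + v 1" using val_mult[of 1 1] by simp
  moreover have "v 1 \<noteq> \<infinity>" by simp
  ultimately show ?thesis using val_not_minus_infinity[of 1] by (cases "v 1") auto
qed

lemma val_uminus [simp]: "v (- x) = v x"
proof -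
  have "v (- 1) + v (- 1) = 0" using val_mult[of "- 1" "- 1"] by simp
  moreover have "v (- 1) \<noteq> \<infinity>" by simp
  ultimately have "v (- 1) = 0" by (cases "v (- 1)") auto
  then show ?thesis using val_mult[of "- 1" x] by simp
qed

lemma val_power: "v (x ^ n) = ereal (real n) * v x"
proof (induction n)
  case 0
  then show ?case by (simp flip: zero_ereal_def)
next
  case (Suc n)
  then show ?case
    using ereal_left_distrib[of 1 "ereal (real n)" "v x"] by (simp add: val_mult one_ereal_def)
qed

lemma prime_char_gt_1: "CHAR('a) > 1"
  using prime_CHAR_semidom[where ?'a = 'a] CHAR_pos prime_gt_1_nat by blast

lemma val_frob_pow_sign:
  shows val_frob_pow_ge_0_iff [simp]: "0 \<le> v (frob_pow i x) \<longleftrightarrow> 0 \<le> v x"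
    and val_frob_pow_gt_0_iff [simp]: "0 < v (frob_pow i x) \<longleftrightarrow> 0 < v x"
    and val_frob_pow_eq_0_iff [simp]: "v (frob_pow i x) = 0 \<longleftrightarrow> v x = 0"
proof -
  define n m where "n = nat \<bar>i\<bar>" and "m = nat (int n + i)"
  have "frob_pow i x ^ (CHAR('a) ^ n) = x ^ (CHAR('a) ^ m)"
    using frob_pow_char[of n i x] by (simp add: n_def m_def)
  then have eq: "ereal (real (CHAR('a) ^ n)) * v (frob_pow i x) = ereal (real (CHAR('a) ^ m)) * v x"
    using val_power by metis
  have pos: "0 < ereal (real (CHAR('a) ^ n))" "0 < ereal (real (CHAR('a) ^ m))"
    using prime_char_gt_1 by auto
  have ge: "0 \<le> r * y \<longleftrightarrow> 0 \<le> y" "0 < r * y \<longleftrightarrow> 0 < y" "r * y = 0 \<longleftrightarrow> y = 0"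
    if "0 < r" for r y :: ereal
    using that by (auto simp: ereal_zero_le_0_iff ereal_zero_less_0_iff)
  show "0 \<le> v (frob_pow i x) \<longleftrightarrow> 0 \<le> v x" "0 < v (frob_pow i x) \<longleftrightarrow> 0 < v x"
    "v (frob_pow i x) = 0 \<longleftrightarrow> v x = 0"
    using ge[OF pos(1), of "v (frob_pow i x)"] ge[OF pos(2), of "v x"] unfolding eq by auto
qed

text \<open>
  The estimate \<open>p\<^sup>d \<ge> 2\<close> in additive form. It makes the Frobenius power contracting on elements of
  positive valuation, and it is behind both rigidity and the solution of additive equations.
\<close>

lemma val_frob_pow_ge_double:
  assumes "0 \<le> v x" "0 < d"
  shows "v x + v x \<le> v (frob_pow d x)"
proof -
  have "CHAR('a) ^ nat d \<ge> 2 ^ nat d"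
    using prime_char_gt_1 by (intro power_mono) auto
  moreover have "(2::nat) ^ nat d \<ge> 2 ^ 1"
    using assms by (intro power_increasing) auto
  ultimately obtain m where m: "CHAR('a) ^ nat d = 2 + m"
    using le_Suc_ex by (metis le_trans power_one_right)
  have "frob_pow d x = x * x * x ^ m"
    using assms by (simp add: frob_pow_def m power_add power2_eq_square)
  then have "v (frob_pow d x) = v x + v x + v (x ^ m)" by (simp add: val_mult)
  moreover have "0 \<le> v (x ^ m)" using assms by (simp add: val_power)
  ultimately show ?thesis by (simp add: add_increasing2)
qed

text \<open>
  Ideals of the valuation ring of the whole perfect field, allowed to be fractional. They treat the
  conditions \<open>0 < v z\<close> and \<open>c \<le> v z\<close> on coefficients uniformly.
\<close>

definition val_ideal :: "'a set \<Rightarrow> bool" where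
  "val_ideal J \<longleftrightarrow>
    0 \<in> J \<and> (\<forall>x\<in>J. \<forall>y\<in>J. x + y \<in> J) \<and> (\<forall>x\<in>J. \<forall>r. 0 \<le> v r \<longrightarrow> r * x \<in> J)"

lemma val_ideal_ge: "val_ideal {z. c \<le> v z}"
  unfolding val_ideal_def
  by (auto simp: val_mult intro: order_trans[OF _ val_add] add_increasing)

lemma val_ideal_gt: "val_ideal {z. 0 < v z}"
  unfolding val_ideal_def
  by (auto simp: val_mult intro: less_le_trans[OF _ val_add] add_nonneg_pos)

lemma val_ideal_Int: "val_ideal I \<Longrightarrow> val_ideal J \<Longrightarrow> val_ideal (I \<inter> J)"
  unfolding val_ideal_def by simp

lemma val_ideal_add: "val_ideal J \<Longrightarrow> x \<in> J \<Longrightarrow> y \<in> J \<Longrightarrow> x + y \<in> J"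
  unfolding val_ideal_def by simp

lemma val_ideal_mult_left: "val_ideal J \<Longrightarrow> x \<in> J \<Longrightarrow> 0 \<le> v r \<Longrightarrow> r * x \<in> J"
  and val_ideal_mult_right: "val_ideal J \<Longrightarrow> x \<in> J \<Longrightarrow> 0 \<le> v r \<Longrightarrow> x * r \<in> J"
  unfolding val_ideal_def by (auto simp: mult.commute)

lemma val_ideal_uminus: "val_ideal J \<Longrightarrow> x \<in> J \<Longrightarrow> - x \<in> J"
  using val_ideal_mult_left[of J x "- 1"] by simp

lemma val_ideal_diff: "val_ideal J \<Longrightarrow> x \<in> J \<Longrightarrow> y \<in> J \<Longrightarrow> x - y \<in> J"
  using val_ideal_add[of J x "- y"] val_ideal_uminus[of J y] by simp

lemma val_ideal_sum: "val_ideal J \<Longrightarrow> (\<And>i. i \<in> S \<Longrightarrow> f i \<in> J) \<Longrightarrow> sum f S \<in> J"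
  by (induction S rule: infinite_finite_induct) (auto simp: val_ideal_def)

lemma val_ideal_frob_pow:
  assumes "val_ideal J" "x \<in> J" "0 \<le> v x" "0 \<le> i"
  shows "frob_pow i x \<in> J"
proof -
  obtain m where "CHAR('a) ^ nat i = Suc m"
    using prime_char_gt_1 by (metis not0_implies_Suc not_one_less_zero power_not_zero)
  then have "frob_pow i x = x ^ m * x"
    using assms by (simp add: frob_pow_def)
  moreover have "0 \<le> v (x ^ m)" using assms by (simp add: val_power)
  ultimately show ?thesis using val_ideal_mult_left assms by simp
qed

lemmas val_integers_ideal = val_ideal_ge[of 0]

lemma tl_mult_in_ideal:
  assumes "val_ideal J" "\<And>i j. tl_coeff x i * frob_pow i (tl_coeff y j) \<in> J"
  shows "tl_coeff (x * y) n \<in> J"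
  using assms by (auto simp: times_twisted_laurent.rep_eq twisted_conv_def intro!: val_ideal_sum)

section \<open>Rigidity of intertwiners\<close>

text \<open>
  Frobenius multiplies the valuation of the top coefficient of \<open>D\<close> on the left of \<open>P D = D Q\<close>, but
  on the right it acts only on a unit.
\<close>

lemma intertwiner_rigid:
  assumes d: "0 < d"
    and P: "\<And>i. i > d \<Longrightarrow> tl_coeff P i = 0" "v (tl_coeff P d) = 0"
    and Q: "\<And>i. i > d \<Longrightarrow> tl_coeff Q i = 0" "v (tl_coeff Q d) = 0"
    and eq: "P * D = D * Q"
    and D: "\<And>i. 0 < v (tl_coeff D i)"
  shows "D = 0"
proof (rule ccontr)
  assume "D \<noteq> 0"
  then obtain m where m: "tl_coeff D m \<noteq> 0" "\<And>i. i > m \<Longrightarrow> tl_coeff D i = 0"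
    using obtain_tl_degree by blast
  let ?u = "v (tl_coeff D m)"
  have "tl_coeff P d * frob_pow d (tl_coeff D m) = tl_coeff D m * frob_pow m (tl_coeff Q d)"
    using tl_coeff_mult_top[of d P m D] tl_coeff_mult_top[of m D d Q] P(1) Q(1) m(2) eq
    by (simp add: add.commute)
  then have "v (tl_coeff P d) + v (frob_pow d (tl_coeff D m))
      = ?u + v (frob_pow m (tl_coeff Q d))" by (metis val_mult)
  moreover have "v (frob_pow m (tl_coeff Q d)) = 0" using Q(2) by simp
  ultimately have "v (frob_pow d (tl_coeff D m)) = ?u" by (simp add: P(2))
  with val_frob_pow_ge_double[of "tl_coeff D m" d] D[of m] d
  have "?u + ?u \<le> ?u" by (simp add: less_imp_le)
  moreover have "?u \<noteq> \<infinity>" using m(1) by simp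
  ultimately show False using D[of m] by (cases ?u) auto
qed

section \<open>Inverses of power series with unit constant coefficient\<close>

lemma right_inverse_exists:
  assumes x: "x \<in> twisted_power_series (valuation_ring UNIV v)" "v (tl_coeff x 0) = 0"
  shows "\<exists>y \<in> twisted_power_series (valuation_ring UNIV v). v (tl_coeff y 0) = 0 \<and> x * y = 1"
proof -
  define rhs where "rhs f n = (if n = 0 then 1 else 0) -
      (\<Sum>k<n. tl_coeff x (- int n + int k) * frob_pow (- int n + int k) (f k))" for f :: "nat \<Rightarrow> 'a" and n
  have vx: "0 \<le> v (tl_coeff x i)" "i > 0 \<Longrightarrow> tl_coeff x i = 0" for i
    using x(1) by (auto simp: twisted_power_series_def valuation_ring_def)
  have x0: "tl_coeff x 0 \<noteq> 0" using x(2) by auto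
  \<comment> \<open>The coefficient of \<open>\<tau>\<^bsup>-n\<^esup>\<close> in \<open>x y = 1\<close>, solved for the term containing the coefficient \<open>f n\<close> of \<open>y\<close>.\<close>
  have "\<exists>f. \<forall>n. 0 \<le> v (f n) \<and> tl_coeff x 0 * f n = rhs f n"
  proof (rule dependent_wellorder_choice)
    fix r n and f g :: "nat \<Rightarrow> 'a"
    assume "\<And>k. k < n \<Longrightarrow> f k = g k"
    then have "rhs f n = rhs g n" by (simp add: rhs_def)
    then show "(0 \<le> v r \<and> tl_coeff x 0 * r = rhs f n) = (0 \<le> v r \<and> tl_coeff x 0 * r = rhs g n)"
      by simp
  next
    fix n and f :: "nat \<Rightarrow> 'a"
    assume IH: "\<And>k. k < n \<Longrightarrow> 0 \<le> v (f k) \<and> tl_coeff x 0 * f k = rhs f k"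
    have "(\<Sum>k<n. tl_coeff x (- int n + int k) * frob_pow (- int n + int k) (f k)) \<in> {z. 0 \<le> v z}"
      using vx IH by (intro val_ideal_sum val_integers_ideal) (simp add: val_mult)
    then have rhs: "0 \<le> v (rhs f n)"
      using val_ideal_diff[OF val_integers_ideal, of "if n = 0 then 1 else 0"] by (simp add: rhs_def)
    define r where "r = rhs f n / tl_coeff x 0"
    have eq: "tl_coeff x 0 * r = rhs f n" using x0 by (simp add: r_def)
    then have "v (rhs f n) = v r" using val_mult[of "tl_coeff x 0" r] x(2) by simp
    with rhs eq show "\<exists>r. 0 \<le> v r \<and> tl_coeff x 0 * r = rhs f n" by metis
  qed
  then obtain f where f: "\<And>n. 0 \<le> v (f n)" "\<And>n. tl_coeff x 0 * f n = rhs f n" by blast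
  define y where "y = series_in_inverse_tau f"
  have "x * y = 1"
  proof (rule twisted_laurent_eqI)
    fix i
    show "tl_coeff (x * y) i = tl_coeff 1 i"
    proof (cases "i > 0")
      case True
      then show ?thesis using tl_coeff_mult_eq_0[of 0 x 0 y i] vx(2) by (simp add: y_def)
    next
      case False
      define n where "n = nat (- i)"
      have i: "i = 0 - int n" using False by (simp add: n_def)
      have "tl_coeff (x * y) i =
          (\<Sum>k\<le>n. tl_coeff x (0 - int n + int k) * frob_pow (0 - int n + int k) (tl_coeff y (- int k)))"
        unfolding i by (rule tl_coeff_mult_series_right) (auto simp: vx(2) y_def)
      also have "\<dots> = tl_coeff x 0 * f n + ((if n = 0 then 1 else 0) - rhs f n)"
        by (simp add: lessThan_Suc_atMost[symmetric] y_def rhs_def)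
      finally show ?thesis using f(2)[of n] by (simp add: i)
    qed
  qed
  moreover have "tl_coeff x 0 * f 0 = 1" using f(2)[of 0] by (simp add: rhs_def)
  then have "v (f 0) = 0" using val_mult[of "tl_coeff x 0" "f 0"] x(2) by simp
  moreover have "y \<in> twisted_power_series (valuation_ring UNIV v)"
    using f(1) by (simp add: twisted_power_series_def valuation_ring_def y_def)
  ultimately show ?thesis by (intro bexI[of _ y]) (auto simp: y_def)
qed

text \<open>
  The right inverse \<open>y\<close> again has a unit as its constant coefficient, so it has a right inverse of
  its own, which can only be \<open>x\<close>.
\<close>

lemma inverse_exists:
  assumes "x \<in> twisted_power_series (valuation_ring UNIV v)" "v (tl_coeff x 0) = 0"
  shows "\<exists>y \<in> twisted_power_series (valuation_ring UNIV v). x * y = 1 \<and> y * x = 1"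
proof -
  obtain y where y: "y \<in> twisted_power_series (valuation_ring UNIV v)" "v (tl_coeff y 0) = 0" "x * y = 1"
    using right_inverse_exists assms by blast
  then obtain z where z: "y * z = 1" using right_inverse_exists by blast
  have "x = x * (y * z)" using z by simp
  also have "\<dots> = z" using y(3) by (simp flip: mult.assoc)
  finally show ?thesis using y z by blast
qed

end

section \<open>A local field with a lift of its residue field\<close>

locale local_field_with_section = valued_perfect_field v
  for v :: "'a::{field, perfect_ring_prime_char} \<Rightarrow> ereal" +
  fixes K :: "'a set" and s :: "'a set \<Rightarrow> 'a"
  assumes local_field: "local_field K v" and section_s: "residue_section K v s"
begin

abbreviation R :: "'a set" where "R \<equiv> valuation_ring K v"

definition lift :: "'a \<Rightarrow> 'a" where "lift c = s (residue_class K v c)"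

lemma K_closed:
  "1 \<in> K" "0 \<in> K" "x \<in> K \<Longrightarrow> y \<in> K \<Longrightarrow> x - y \<in> K" "x \<in> K \<Longrightarrow> y \<in> K \<Longrightarrow> x + y \<in> K"
  "x \<in> K \<Longrightarrow> y \<in> K \<Longrightarrow> x * y \<in> K" "x \<in> K \<Longrightarrow> y \<in> K \<Longrightarrow> x / y \<in> K"
proof -
  have K: "1 \<in> K" "\<And>x y. x \<in> K \<Longrightarrow> y \<in> K \<Longrightarrow> x - y \<in> K \<and> x * y \<in> K"
    "\<And>x. x \<in> K \<Longrightarrow> inverse x \<in> K"
    using local_field by (auto simp: local_field_def subfield_of_type_def)
  show "1 \<in> K" by (rule K)
  show zero: "0 \<in> K" using K(2)[OF K(1) K(1)] by simp
  show "x - y \<in> K" if "x \<in> K" "y \<in> K" using K that by blast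
  show "x + y \<in> K" if "x \<in> K" "y \<in> K"
    using K(2)[of x "0 - y"] K(2)[of 0 y] zero that by simp
  show "x * y \<in> K" if "x \<in> K" "y \<in> K" using K that by blast
  show "x / y \<in> K" if "x \<in> K" "y \<in> K" using K that by (simp add: divide_inverse)
qed

lemma K_power: "x \<in> K \<Longrightarrow> x ^ n \<in> K"
  by (induction n) (auto intro: K_closed)

lemma K_frob_pow: "x \<in> K \<Longrightarrow> 0 \<le> i \<Longrightarrow> frob_pow i x \<in> K"
  by (simp add: frob_pow_def K_power)

lemma K_sum: "(\<And>i. i \<in> S \<Longrightarrow> f i \<in> K) \<Longrightarrow> sum f S \<in> K"
  by (induction S rule: infinite_finite_induct) (auto intro: K_closed)

lemma R_iff: "x \<in> R \<longleftrightarrow> x \<in> K \<and> 0 \<le> v x"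
  by (simp add: valuation_ring_def)

lemma R_closed: "0 \<in> R" "1 \<in> R" "x \<in> R \<Longrightarrow> y \<in> R \<Longrightarrow> x + y \<in> R \<and> x * y \<in> R"
  by (auto simp: R_iff K_closed val_mult order_trans[OF _ val_add])

lemma lift_props:
  shows lift_in_R: "x \<in> R \<Longrightarrow> lift x \<in> R"
    and lift_cong: "x \<in> R \<Longrightarrow> 0 < v (x - lift x)"
    and lift_hom: "x \<in> R \<Longrightarrow> y \<in> R \<Longrightarrow> lift (x + y) = lift x + lift y \<and> lift (x * y) = lift x * lift y"
    and lift_1: "lift 1 = 1"
    and lift_0: "lift 0 = 0"
proof -
  have cl: "s (residue_class K v x) \<in> R \<and> residue_class K v (s (residue_class K v x)) = residue_class K v x"
    if "x \<in> R" for x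
    using section_s that by (auto simp: residue_section_def residue_field_def)
  show "lift x \<in> R" if "x \<in> R" using cl that by (simp add: lift_def)
  have self: "x \<in> residue_class K v x"
    by (simp add: residue_class_def maximal_ideal_def K_closed)
  show "0 < v (x - lift x)" if "x \<in> R"
  proof -
    have "x \<in> residue_class K v (lift x)" using self cl[OF that] by (simp add: lift_def)
    then show ?thesis by (simp add: residue_class_def maximal_ideal_def)
  qed
  show hom: "lift (x + y) = lift x + lift y \<and> lift (x * y) = lift x * lift y"
    if "x \<in> R" "y \<in> R" for x y
    using section_s that by (simp add: residue_section_def lift_def)
  show "lift 1 = 1" using section_s by (simp add: residue_section_def lift_def)
  show "lift 0 = 0" using hom[OF R_closed(1) R_closed(1)] by (metis add.right_neutral add_left_cancel)
qed

text \<open>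
  The Frobenius is injective on the finite image of \<open>lift\<close>, which it maps into itself; so it
  permutes this image, and the image contains the \<open>p\<close>-th roots of its elements.
\<close>

lemma frob_pow_lift_in_R:
  assumes "x \<in> R"
  shows "frob_pow i (lift x) \<in> R"
proof (cases "0 \<le> i")
  case True
  then show ?thesis using lift_in_R[OF assms] by (simp add: R_iff K_frob_pow)
next
  case False
  define f where "f = (\<lambda>c::'a. c ^ (CHAR('a) ^ nat (- i)))"
  have lift_power: "x ^ n \<in> R \<and> lift (x ^ n) = lift x ^ n" if "x \<in> R" for x n
    by (induction n) (use that R_closed lift_1 lift_hom in auto)
  have "lift ` R = s ` residue_field K v"
    by (auto simp: lift_def residue_field_def)
  moreover have "finite (residue_field K v)" using local_field by (simp add: local_field_def)
  ultimately have "finite (lift ` R)" by simp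
  moreover have "f ` (lift ` R) \<subseteq> lift ` R"
  proof
    fix c assume "c \<in> f ` (lift ` R)"
    then obtain y where "y \<in> R" "c = f (lift y)" by blast
    then show "c \<in> lift ` R"
      using lift_power[of y "CHAR('a) ^ nat (- i)"]
      by (intro image_eqI[of _ _ "y ^ (CHAR('a) ^ nat (- i))"]) (simp_all add: f_def)
  qed
  moreover have "inj_on f (lift ` R)" by (rule inj_onI) (auto simp: f_def dest: frob_pow_inj)
  ultimately have "f ` (lift ` R) = lift ` R" by (rule endo_inj_surj)
  then obtain y where y: "y \<in> R" "lift x = f (lift y)" using assms by blast
  have "frob_pow i (lift x) = lift y"
    by (rule frob_pow_unique) (use False y in \<open>simp add: f_def\<close>)
  then show ?thesis using lift_in_R y by simp
qed

section \<open>Existence of intertwiners\<close>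

text \<open>
  The iteration \<open>z \<mapsto> (a z\<^bsup>q\<^esup> - c) / b\<close> with \<open>q = p\<^sup>d\<close>, started at \<open>0\<close>, converges: by additivity of
  the Frobenius, consecutive differences are mapped to \<open>a / b\<close> times their \<open>q\<close>-th powers, so their
  valuations at least double.
\<close>

lemma additive_equation_solvable:
  assumes a: "a \<in> K" "v a = 0" and b: "b \<in> K" "v b = 0" and c: "c \<in> K" "0 < v c" and d: "0 < d"
  shows "\<exists>z\<in>K. a * frob_pow d z - b * z = c \<and> v c \<le> v z"
proof (cases "c = 0")
  case True
  then show ?thesis using K_closed by (intro bexI[of _ 0]) auto
next
  case False
  then obtain t where t: "v c = ereal t" "0 < t"
    using c(2) by (cases "v c") auto
  have b0: "b \<noteq> 0" using b by auto
  define Z where "Z = rec_nat 0 (\<lambda>_ z. (a * frob_pow d z - c) / b)"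
  have Z0: "Z 0 = 0" and Z_Suc: "b * Z (Suc n) = a * frob_pow d (Z n) - c" for n
    using b0 by (simp_all add: Z_def)
  have ZK: "Z n \<in> K" for n
    by (induction n) (use a b c d in \<open>auto simp: Z_def intro!: K_closed K_frob_pow\<close>)
  \<comment> \<open>Linear growth of the valuations follows from doubling and is enough for convergence.\<close>
  have increment: "ereal (real (Suc n) * t) \<le> v (Z (Suc n) - Z n)" for n
  proof (induction n)
    case 0
    have "b * Z 1 = - c" using Z_Suc[of 0] by (simp add: Z0)
    then have "v b + v (Z 1) = v c" by (metis val_mult val_uminus)
    then show ?case using b t by (simp add: Z0)
  next
    case (Suc n)
    let ?D = "Z (Suc n) - Z n"
    have "0 \<le> real (Suc n) * t" using t by simp
    then have "0 \<le> v ?D" using Suc order_trans by (metis ereal_less_eq(5))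
    have "b * (Z (Suc (Suc n)) - Z (Suc n)) = a * frob_pow d ?D"
      by (simp add: right_diff_distrib Z_Suc frob_pow_diff)
    then have "v (Z (Suc (Suc n)) - Z (Suc n)) = v (frob_pow d ?D)"
      using a b by (metis add_0 val_mult)
    then have "v ?D + v ?D \<le> v (Z (Suc (Suc n)) - Z (Suc n))"
      using val_frob_pow_ge_double[OF \<open>0 \<le> v ?D\<close> d] by simp
    moreover have "ereal (real (Suc (Suc n)) * t) \<le> ereal (real (Suc n) * t) + ereal (real (Suc n) * t)"
      using t by (simp add: algebra_simps)
    ultimately show ?case using add_mono[OF Suc Suc] by (meson order_trans)
  qed
  have close: "ereal (real (Suc N) * t) \<le> v (Z n - Z N)" if "N \<le> n" for n N
    using that
  proof (induction n rule: dec_induct)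
    case base
    then show ?case by simp
  next
    case (step n)
    have "ereal (real (Suc N) * t) \<le> ereal (real (Suc n) * t)"
      using step t by simp
    then have "ereal (real (Suc N) * t) \<le> min (v (Z (Suc n) - Z n)) (v (Z n - Z N))"
      using step increment[of n] by (metis min.boundedI order_trans)
    also have "\<dots> \<le> v (Z (Suc n) - Z N)"
      using val_add[of "Z (Suc n) - Z n" "Z n - Z N"] by simp
    finally show ?case .
  qed
  have cauchy: "\<exists>N. \<forall>m\<ge>N. \<forall>n\<ge>N. ereal r < v (Z m - Z n)" for r
  proof -
    obtain N where N: "r < real N * t" using reals_Archimedean3[OF t(2)] by blast
    have "ereal r < v (Z m - Z n)" if "m \<ge> N" "n \<ge> N" for m n
    proof -
      have "ereal r < ereal (real (Suc N) * t)" using N t by (simp add: algebra_simps)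
      also have "\<dots> \<le> min (v (Z m - Z N)) (v (Z N - Z n))"
        using close[OF that(1)] close[OF that(2)] val_uminus[of "Z n - Z N"] by simp
      also have "\<dots> \<le> v (Z m - Z n)" using val_add[of "Z m - Z N" "Z N - Z n"] by simp
      finally show ?thesis .
    qed
    then show ?thesis by blast
  qed
  then obtain L where L: "L \<in> K" "\<And>r. \<exists>N. \<forall>n\<ge>N. ereal r < v (Z n - L)"
    using local_field ZK unfolding local_field_def valuation_complete_def by metis
  have "v (a * frob_pow d L - c - b * L) = \<infinity>"
  proof (rule ereal_top)
    fix r
    obtain N where N: "\<And>n. n \<ge> N \<Longrightarrow> ereal \<bar>r\<bar> < v (Z n - L)" using L(2)[of "\<bar>r\<bar>"] by blast
    let ?I = "{z. ereal \<bar>r\<bar> \<le> v z}"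
    have eq: "a * frob_pow d L - c - b * L = b * (Z (Suc N) - L) - a * frob_pow d (Z N - L)"
      by (simp add: right_diff_distrib Z_Suc frob_pow_diff)
    have "Z (Suc N) - L \<in> ?I" using N[of "Suc N"] by simp
    then have 1: "b * (Z (Suc N) - L) \<in> ?I" using b by (intro val_ideal_mult_left val_ideal_ge) auto
    have "Z N - L \<in> ?I" using N[of N] by simp
    moreover have "0 \<le> v (Z N - L)"
      using N[of N] by (metis abs_ge_zero ereal_less_eq(5) le_refl less_imp_le order_trans)
    ultimately have "frob_pow d (Z N - L) \<in> ?I"
      using val_ideal_frob_pow[OF val_ideal_ge] d by simp
    then have 2: "a * frob_pow d (Z N - L) \<in> ?I"
      using a by (intro val_ideal_mult_left val_ideal_ge) auto
    have "a * frob_pow d L - c - b * L \<in> ?I" unfolding eq by (intro val_ideal_diff val_ideal_ge 1 2)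
    then have "ereal \<bar>r\<bar> \<le> v (a * frob_pow d L - c - b * L)" by simp
    moreover have "ereal r \<le> ereal \<bar>r\<bar>" by simp
    ultimately show "ereal r \<le> v (a * frob_pow d L - c - b * L)" by (rule order_trans[rotated])
  qed
  then have "a * frob_pow d L - b * L = c" by (simp add: algebra_simps)
  moreover have "v c \<le> v L"
  proof -
    obtain N where N: "ereal t < v (Z N - L)" using L(2)[of t] by blast
    have "v c \<le> v (Z N)"
      using close[of 0 N] t Z0 by simp
    then have "v c \<le> min (v (Z N)) (v (L - Z N))"
      using N t val_uminus[of "Z N - L"] by simp
    also have "\<dots> \<le> v L" using val_add[of "Z N" "L - Z N"] by simp
    finally show ?thesis .
  qed
  ultimately show ?thesis using L by blast
qed

text \<open>
  Choosing the coefficients of \<open>x\<close> one after another, with \<open>x - 1\<close> kept in the ideal \<open>J\<close>. The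
  conclusion on \<open>x - 1\<close> contains both the congruence modulo the maximal ideal and the bound by
  \<open>w\<close>.
\<close>

lemma intertwiner_exists:
  fixes d w
  defines "J \<equiv> {z. 0 < v z \<and> w \<le> v z}"
  assumes d: "0 < d"
    and P: "\<And>i. i > d \<Longrightarrow> tl_coeff P i = 0" "v (tl_coeff P d) = 0"
      "\<And>i. tl_coeff P i \<in> R" "\<And>i. i < 0 \<Longrightarrow> tl_coeff P i = 0"
    and Q: "\<And>i. i > d \<Longrightarrow> tl_coeff Q i = 0" "v (tl_coeff Q d) = 0"
      "\<And>i j. frob_pow j (tl_coeff Q i) \<in> R"
    and PQ: "\<And>i. tl_coeff (P - Q) i \<in> J"
  shows "\<exists>x \<in> twisted_power_series R. (\<forall>i. tl_coeff (x - 1) i \<in> J) \<and> P * x = x * Q"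
proof -
  let ?\<delta> = "\<lambda>n::nat. if n = 0 then 1 else 0 :: 'a"
  let ?a = "\<lambda>n k. tl_coeff P (d - int n + int k)"
  let ?l = "\<lambda>n k f. ?a n k * frob_pow (d - int n + int k) (f k)"
  let ?r = "\<lambda>n k f. f k * frob_pow (- int k) (tl_coeff Q (d - int n + int k))"
  \<comment> \<open>\<open>f k\<close> stands for the coefficient of \<open>\<tau>\<^bsup>-k\<^esup>\<close> in \<open>x\<close>; \<open>?l\<close> and \<open>?r\<close> are its contributions to the
    coefficients of \<open>\<tau>\<^bsup>d-n\<^esup>\<close> in \<open>P x\<close> and \<open>x Q\<close>. The terms for \<open>k = n\<close> contain the unknown.\<close>
  define rhs where "rhs f n = (\<Sum>k<n. ?r n k f - ?l n k f)" for f :: "nat \<Rightarrow> 'a" and n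
  define good where "good f n z \<longleftrightarrow> z \<in> K \<and> z - ?\<delta> n \<in> J \<and>
      tl_coeff P d * frob_pow d z - z * frob_pow (- int n) (tl_coeff Q d) = rhs f n"
    for f :: "nat \<Rightarrow> 'a" and n z
  have J: "val_ideal J"
    using val_ideal_Int[OF val_ideal_gt val_ideal_ge[of w]] by (simp add: J_def Int_def)
  have J_pos: "0 < v z" if "z \<in> J" for z using that by (simp add: J_def)
  have PK: "tl_coeff P i \<in> K" "0 \<le> v (tl_coeff P i)" for i using P(3) by (auto simp: R_iff)
  have QK: "frob_pow j (tl_coeff Q i) \<in> K" "0 \<le> v (tl_coeff Q i)" for i j
    using Q(3)[of j i] Q(3)[of 0 i] by (auto simp: R_iff)
  \<comment> \<open>Modulo \<open>J\<close> the term for \<open>k = 0\<close> is a difference of coefficients of \<open>Q\<close> and \<open>P\<close>, which lies in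
    \<open>J\<close> as well; the other terms have a factor in \<open>J\<close>.\<close>
  have defect: "?r n k f - ?l n k f \<in> J" if fk: "f k - ?\<delta> k \<in> J" for f n k
  proof -
    let ?z = "f k - ?\<delta> k" and ?i = "d - int n + int k"
    have "?a n k * frob_pow ?i ?z \<in> J"
    proof (cases "?i < 0")
      case True
      then show ?thesis using P(4)[of ?i] J by (simp add: val_ideal_def)
    next
      case False
      then show ?thesis
        using fk J_pos[OF fk] PK by (intro val_ideal_mult_left val_ideal_frob_pow J) auto
    qed
    moreover have "?z * frob_pow (- int k) (tl_coeff Q ?i) \<in> J"
      using fk QK by (intro val_ideal_mult_right J) auto
    moreover have "?\<delta> k * (tl_coeff P ?i - tl_coeff Q ?i) \<in> J"
      using PQ[of ?i] J by (intro val_ideal_mult_left) auto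
    ultimately have "?z * frob_pow (- int k) (tl_coeff Q ?i) - ?a n k * frob_pow ?i ?z
        - ?\<delta> k * (tl_coeff P ?i - tl_coeff Q ?i) \<in> J"
      by (intro val_ideal_diff J)
    then show ?thesis by (auto simp: frob_pow_diff algebra_simps split: if_splits)
  qed
  have "\<exists>f. \<forall>n. good f n (f n)"
  proof (rule dependent_wellorder_choice)
    fix z n and f g :: "nat \<Rightarrow> 'a"
    assume "\<And>k. k < n \<Longrightarrow> f k = g k"
    then have "rhs f n = rhs g n" by (simp add: rhs_def)
    then show "good f n z = good g n z" by (simp add: good_def)
  next
    fix n and f :: "nat \<Rightarrow> 'a"
    assume IH: "\<And>k. k < n \<Longrightarrow> good f k (f k)"
    let ?b = "frob_pow (- int n) (tl_coeff Q d)"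
    \<comment> \<open>The right-hand side of the equation for the deviation of the new coefficient from its
      expected value \<open>?\<delta> n\<close>.\<close>
    define c where "c = rhs f n - ?\<delta> n * (tl_coeff P d - tl_coeff Q d)"
    have "rhs f n \<in> J" unfolding rhs_def
      using IH by (intro val_ideal_sum J defect) (auto simp: good_def)
    moreover have "?\<delta> n * (tl_coeff P d - tl_coeff Q d) \<in> J"
      using PQ[of d] J by (intro val_ideal_mult_left) auto
    ultimately have cJ: "c \<in> J" unfolding c_def by (intro val_ideal_diff J)
    have lK: "?l n k f \<in> K" if "k < n" for k
    proof (cases "d - int n + int k < 0")
      case True
      then show ?thesis using P(4) K_closed by simp
    next
      case False
      then show ?thesis using PK IH[OF that] by (intro K_closed K_frob_pow) (auto simp: good_def)
    qed
    have "?r n k f \<in> K" if "k < n" for k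
      using IH[OF that] QK by (auto simp: good_def K_closed)
    with lK have "rhs f n \<in> K" unfolding rhs_def
      by (intro K_sum K_closed(3)) auto
    then have cK: "c \<in> K" unfolding c_def
      using PK QK[of 0] by (intro K_closed) (auto simp: K_closed)
    obtain z where z: "z \<in> K" "tl_coeff P d * frob_pow d z - ?b * z = c" "v c \<le> v z"
      using additive_equation_solvable[of "tl_coeff P d" ?b c d] PK P(2) QK Q(2) cK J_pos[OF cJ] d
      by auto
    have "z \<in> J" using z(3) cJ by (auto simp: J_def)
    moreover have "tl_coeff P d * frob_pow d (?\<delta> n + z) - (?\<delta> n + z) * ?b = rhs f n"
      using z(2) by (auto simp: c_def frob_pow_add algebra_simps split: if_splits)
    ultimately have "good f n (?\<delta> n + z)"
      using z(1) by (auto simp: good_def K_closed)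
    then show "\<exists>z. good f n z" by blast
  qed
  then obtain f where f: "\<And>n. good f n (f n)" by blast
  define x where "x = series_in_inverse_tau f"
  have fJ: "f n - ?\<delta> n \<in> J" for n using f by (simp add: good_def)
  have "0 \<le> v (f n)" for n
    using val_ideal_add[OF val_integers_ideal, of "f n - ?\<delta> n" "?\<delta> n"] J_pos[OF fJ[of n]]
    by (simp add: less_imp_le)
  then have "x \<in> twisted_power_series R"
    using f by (auto simp: twisted_power_series_def x_def R_iff good_def K_closed)
  moreover have "tl_coeff (x - 1) i \<in> J" for i
    using fJ[of "nat (- i)"] J by (auto simp: x_def val_ideal_def)
  moreover have "P * x = x * Q"
  proof (rule twisted_laurent_eqI)
    fix m
    have x0: "tl_coeff x i = 0" if "i > 0" for i using that by (simp add: x_def)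
    show "tl_coeff (P * x) m = tl_coeff (x * Q) m"
    proof (cases "m > d")
      case True
      then show ?thesis
        using tl_coeff_mult_eq_0[of d P 0 x m] tl_coeff_mult_eq_0[of 0 x d Q m] P(1) Q(1) x0 by simp
    next
      case False
      define n where "n = nat (d - m)"
      have m: "m = d - int n" using False by (simp add: n_def)
      have "tl_coeff (P * x) m = (\<Sum>k\<le>n. ?l n k f)" unfolding m
        by (subst tl_coeff_mult_series_right) (use P(1) x0 in \<open>auto simp: x_def\<close>)
      also have "\<dots> = (\<Sum>k<n. ?l n k f) + tl_coeff P d * frob_pow d (f n)"
        by (simp add: lessThan_Suc_atMost[symmetric])
      also have "\<dots> = (\<Sum>k<n. ?r n k f) + f n * frob_pow (- int n) (tl_coeff Q d)"
        using f[of n] by (simp add: good_def rhs_def sum_subtractf algebra_simps)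
      also have "\<dots> = (\<Sum>k\<le>n. ?r n k f)"
        by (simp add: lessThan_Suc_atMost[symmetric])
      also have "\<dots> = tl_coeff (x * Q) m" unfolding m
        by (subst tl_coeff_mult_series_left) (use Q(1) x0 in \<open>auto simp: x_def\<close>)
      finally show ?thesis .
    qed
  qed
  ultimately show ?thesis by blast
qed

end

section \<open>Conjugating a Drinfeld module into its reduction\<close>

theorem proposition9p2:
  fixes K :: "'l::{field, perfect_ring_prime_char} set"
    and v :: "'l \<Rightarrow> ereal"
    and s :: "'l set \<Rightarrow> 'l"
    and infty :: "'f::field_prime_char \<Rightarrow> ereal"
    and A :: "'f set"
    and \<psi> \<phi> :: "'f \<Rightarrow> 'l twisted_laurent"
    and w :: ereal
  assumes K: "local_field_in_perfection K v"
    and s: "residue_section K v s"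
    and F: "global_function_field TYPE('f)" "CHAR('f) = CHAR('l)"
    and infty: "infty \<in> places"
    and A: "A = regular_outside infty"
    and \<psi>: "drinfeld_good_reduction A (valuation_ring K v) \<psi>"
    and \<phi>: "\<phi> = lifted_reduction K v s \<psi>"
    and w: "w = (INF a\<in>A. tl_val v (\<psi> a - \<phi> a))"
  shows "(\<exists>!x. x \<in> twisted_power_series (valuation_ring K v) \<and> congruent_one K v x \<and>
            (\<forall>a\<in>A. \<psi> a * x = x * \<phi> a)) \<and>
         (\<forall>x. x \<in> twisted_power_series (valuation_ring K v) \<and> congruent_one K v x \<and>
            (\<forall>a\<in>A. \<psi> a * x = x * \<phi> a) \<longrightarrow>
           (\<exists>y \<in> twisted_power_series (valuation_ring UNIV v). x * y = 1 \<and> y * x = 1 \<and>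
              w \<le> tl_val v (x - 1) \<and> w \<le> tl_val v (y - 1)))"
proof -
  interpret valued_perfect_field v
    using K by unfold_locales (simp add: local_field_in_perfection_def)
  interpret local_field_with_section v K s
    using K s by unfold_locales (auto simp: local_field_in_perfection_def)
  let ?R = "valuation_ring K v"
  let ?J = "{z. 0 < v z \<and> w \<le> v z}"
  have \<psi>_poly: "\<psi> a \<in> twisted_polys ?R" if "a \<in> A" for a
    using \<psi> that by (auto simp: drinfeld_good_reduction_def)
  have \<psi>_R: "tl_coeff (\<psi> a) i \<in> ?R" "i < 0 \<Longrightarrow> tl_coeff (\<psi> a) i = 0" if "a \<in> A" for a i
    using \<psi>_poly[OF that] by (auto simp: twisted_polys_def)
  have \<psi>_hom: "\<psi> (a + b) = \<psi> a + \<psi> b" "\<psi> (a * b) = \<psi> a * \<psi> b" if "a \<in> A" "b \<in> A" for a b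
    using \<psi> that by (auto simp: drinfeld_good_reduction_def ring_hom_on_def)
  have \<phi>_map: "\<phi> a = tl_map lift (\<psi> a)" for a
    by (simp add: \<phi> lifted_reduction_def lift_def[abs_def])
  have \<phi>_coeff: "tl_coeff (\<phi> a) i = lift (tl_coeff (\<psi> a) i)" for a i
    by (simp add: \<phi>_map tl_coeff_tl_map lift_0)
  have \<phi>_R: "tl_coeff (\<phi> a) i \<in> ?R" if "a \<in> A" for a i
    using \<psi>_R[OF that] lift_in_R by (simp add: \<phi>_coeff)
  have \<phi>_mult: "\<phi> (a * b) = \<phi> a * \<phi> b" if "a \<in> A" "b \<in> A" for a b
    unfolding \<phi>_map using R_closed lift_0 lift_1 lift_hom \<psi>_poly \<psi>_hom that
    by (simp add: tl_map_mult[of ?R])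
  have \<psi>\<phi>_J: "tl_coeff (\<psi> a - \<phi> a) i \<in> ?J" if "a \<in> A" for a i
  proof -
    have "w \<le> tl_val v (\<psi> a - \<phi> a)" unfolding w using that by (rule INF_lower)
    also have "\<dots> \<le> v (tl_coeff (\<psi> a - \<phi> a) i)" unfolding tl_val_def by (rule INF_lower) simp
    finally show ?thesis using lift_cong \<psi>_R(1)[OF that] by (simp add: \<phi>_coeff)
  qed

  have "\<not> \<psi> ` A \<subseteq> tl_const ` ?R"
    using \<psi> unfolding drinfeld_good_reduction_def by (elim conjE)
  then obtain a where a: "a \<in> A" "\<psi> a \<notin> tl_const ` ?R"
    by (meson image_subsetI)
  have "tl_const 0 = (0 :: 'l twisted_laurent)"
    by (rule twisted_laurent_eqI) simp
  then have \<psi>a_nz: "\<psi> a \<noteq> 0" using a(2) R_closed(1) by force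
  have "a \<noteq> 0" using \<psi>_hom(1)[of a a] a(1) \<psi>a_nz by force
  \<comment> \<open>As \<open>\<psi> a\<close> is not constant, the degree \<open>d\<close> is positive, as contraction and rigidity require.\<close>
  obtain d where d: "tl_coeff (\<psi> a) d \<noteq> 0" "\<And>i. i > d \<Longrightarrow> tl_coeff (\<psi> a) i = 0"
    using obtain_tl_degree[OF \<psi>a_nz] by blast
  have "d > 0"
  proof (rule ccontr)
    assume "\<not> d > 0"
    then have "\<psi> a = tl_const (tl_coeff (\<psi> a) 0)"
      using d(2) \<psi>_R(2)[OF a(1)] by (intro twisted_laurent_eqI) (auto simp: neq_iff)
    then show False using a \<psi>_R(1) by blast
  qed
  have \<psi>d: "v (tl_coeff (\<psi> a) d) = 0"
  proof -
    have "\<exists>u\<in>?R. tl_lead_coeff (\<psi> a) * u = 1"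
      using \<psi> a(1) \<open>a \<noteq> 0\<close> unfolding drinfeld_good_reduction_def by (elim conjE) simp
    moreover have "tl_lead_coeff (\<psi> a) = tl_coeff (\<psi> a) d"
      using d by (rule tl_lead_coeff_eq)
    ultimately obtain u where u: "u \<in> ?R" "tl_coeff (\<psi> a) d * u = 1" by auto
    then have "v (tl_coeff (\<psi> a) d) + v u = 0" using val_mult val_1 by metis
    moreover have "0 \<le> v (tl_coeff (\<psi> a) d)" "0 \<le> v u" using \<psi>_R(1)[OF a(1)] u by (auto simp: R_iff)
    ultimately show ?thesis using add_nonneg_eq_0_iff by blast
  qed
  have \<phi>0: "tl_coeff (\<phi> a) i = 0" if "i > d" for i using d(2)[OF that] by (simp add: \<phi>_coeff lift_0)
  have \<phi>d: "v (tl_coeff (\<phi> a) d) = 0"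
  proof -
    have "\<not> 0 < v (tl_coeff (\<phi> a) d)"
    proof
      assume "0 < v (tl_coeff (\<phi> a) d)"
      then have "tl_coeff (\<psi> a - \<phi> a) d + tl_coeff (\<phi> a) d \<in> {z. 0 < v z}"
        using \<psi>\<phi>_J[OF a(1), of d] by (intro val_ideal_add val_ideal_gt) auto
      then show False using \<psi>d by simp
    qed
    then show ?thesis using \<phi>_R[OF a(1), of d] by (simp add: R_iff)
  qed
  have rigid: "D = 0" if "\<psi> a * D = D * \<phi> a" "\<And>i. 0 < v (tl_coeff D i)" for D
    using intertwiner_rigid[OF \<open>d > 0\<close> d(2) \<psi>d \<phi>0 \<phi>d that] .

  have "\<exists>x \<in> twisted_power_series ?R. (\<forall>i. tl_coeff (x - 1) i \<in> ?J) \<and> \<psi> a * x = x * \<phi> a"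
    using \<open>d > 0\<close> d(2) \<psi>d \<psi>_R[OF a(1)] \<phi>0 \<phi>d \<psi>\<phi>_J[OF a(1)]
    by (intro intertwiner_exists[of d]) (auto simp: \<phi>_coeff intro: frob_pow_lift_in_R)
  then obtain x where x: "x \<in> twisted_power_series ?R" "\<And>i. tl_coeff (x - 1) i \<in> ?J"
    "\<psi> a * x = x * \<phi> a" by blast
  have x_K: "tl_coeff x i \<in> K" "0 \<le> v (tl_coeff x i)" for i
    using x(1) by (auto simp: twisted_power_series_def R_iff)
  have x_one: "congruent_one K v x"
    unfolding congruent_one_def maximal_ideal_def
  proof (intro conjI allI impI)
    show "tl_coeff x 0 - 1 \<in> {z\<in>K. 0 < v z}"
      using x(2)[of 0] x_K(1)[of 0] K_closed by simp
    show "tl_coeff x j \<in> {z\<in>K. 0 < v z}" if "j < 0" for j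
      using x(2)[of j] x_K(1)[of j] that by simp
  qed
  have x_all: "\<psi> b * x = x * \<phi> b" if b: "b \<in> A" for b
  proof -
    define D where "D = \<psi> b * x - x * \<phi> b"
    have \<psi>_comm: "\<psi> a * \<psi> b = \<psi> b * \<psi> a"
      using \<psi>_hom(2)[OF a(1) b] \<psi>_hom(2)[OF b a(1)] by (simp add: mult.commute)
    have \<phi>_comm: "\<phi> a * \<phi> b = \<phi> b * \<phi> a"
      using \<phi>_mult[OF a(1) b] \<phi>_mult[OF b a(1)] by (simp add: mult.commute)
    have "\<psi> a * D = \<psi> b * (\<psi> a * x) - (\<psi> a * x) * \<phi> b"
      by (simp add: D_def right_diff_distrib \<psi>_comm flip: mult.assoc)
    also have "\<dots> = D * \<phi> a"
      by (simp add: D_def left_diff_distrib x(3) \<phi>_comm mult.assoc)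
    finally have "\<psi> a * D = D * \<phi> a" .
    moreover have "0 < v (tl_coeff D i)" for i
    proof -
      \<comment> \<open>Each summand has a factor that vanishes modulo the maximal ideal.\<close>
      have D: "D = \<psi> b * (x - 1) - (x - 1) * \<phi> b + (\<psi> b - \<phi> b)"
        by (simp add: D_def algebra_simps)
      have "tl_coeff (\<psi> b * (x - 1)) i \<in> {z. 0 < v z}"
        using x(2) \<psi>_R[OF b]
        by (intro tl_mult_in_ideal val_ideal_gt val_ideal_mult_left) (auto simp: R_iff)
      moreover have "tl_coeff ((x - 1) * \<phi> b) i \<in> {z. 0 < v z}"
        using x(2) \<phi>_R[OF b]
        by (intro tl_mult_in_ideal val_ideal_gt val_ideal_mult_right) (auto simp: R_iff)
      moreover have "tl_coeff (\<psi> b - \<phi> b) i \<in> {z. 0 < v z}"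
        using \<psi>\<phi>_J[OF b, of i] by simp
      ultimately have "tl_coeff D i \<in> {z. 0 < v z}"
        unfolding D tl_coeff_simps(3)[of "_ - _"] tl_coeff_simps(4)[of "_ * _" "_ * _"]
        by (intro val_ideal_add val_ideal_diff val_ideal_gt)
      then show ?thesis by simp
    qed
    ultimately have "D = 0" by (rule rigid)
    then show ?thesis by (simp add: D_def)
  qed
  have unique: "x' = x"
    if x': "x' \<in> twisted_power_series ?R" "congruent_one K v x'" "\<forall>b\<in>A. \<psi> b * x' = x' * \<phi> b" for x'
  proof -
    have "0 < v (tl_coeff (x' - x) i)" for i
    proof -
      have "tl_coeff (x' - 1) i \<in> {z. 0 < v z}"
        using x' by (cases i "0 :: int" rule: linorder_cases)
          (auto simp: congruent_one_def maximal_ideal_def twisted_power_series_def)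
      moreover have "tl_coeff (x - 1) i \<in> {z. 0 < v z}" using x(2)[of i] by simp
      ultimately have "tl_coeff (x' - 1) i - tl_coeff (x - 1) i \<in> {z. 0 < v z}"
        by (intro val_ideal_diff val_ideal_gt)
      then show ?thesis by simp
    qed
    moreover have "\<psi> a * (x' - x) = (x' - x) * \<phi> a"
      using x'(3) a(1) x(3) by (simp add: algebra_simps)
    ultimately have "x' - x = 0" using rigid by blast
    then show ?thesis by simp
  qed
  have "v (tl_coeff x 0) = 0"
  proof -
    have "\<not> 0 < v (tl_coeff x 0)"
    proof
      assume "0 < v (tl_coeff x 0)"
      then have "tl_coeff x 0 - tl_coeff (x - 1) 0 \<in> {z. 0 < v z}"
        using x(2)[of 0] by (intro val_ideal_diff val_ideal_gt) auto
      then show False by simp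
    qed
    then show ?thesis using x_K(2)[of 0] by simp
  qed
  moreover have "x \<in> twisted_power_series (valuation_ring UNIV v)"
    using x(1) by (auto simp: twisted_power_series_def valuation_ring_def)
  ultimately obtain y where y: "y \<in> twisted_power_series (valuation_ring UNIV v)" "x * y = 1" "y * x = 1"
    using inverse_exists by blast
  have x_bound: "w \<le> tl_val v (x - 1)"
    unfolding tl_val_def using x(2) by (intro INF_greatest) simp
  have y_bound: "w \<le> tl_val v (y - 1)"
    unfolding tl_val_def
  proof (rule INF_greatest)
    fix i
    have "tl_coeff ((x - 1) * y) i \<in> {z. w \<le> v z}"
      using x(2) y(1) by (intro tl_mult_in_ideal val_ideal_ge val_ideal_mult_right)
        (auto simp: twisted_power_series_def valuation_ring_def)
    then have "w \<le> v (tl_coeff (- ((x - 1) * y)) i)" by simp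
    also have "- ((x - 1) * y) = y - 1" using y(2) by (simp add: left_diff_distrib)
    finally show "w \<le> v (tl_coeff (y - 1) i)" .
  qed
  have "\<exists>!x. x \<in> twisted_power_series ?R \<and> congruent_one K v x \<and> (\<forall>a\<in>A. \<psi> a * x = x * \<phi> a)"
    using x(1) x_one x_all unique by blast
  moreover have "\<forall>x. x \<in> twisted_power_series ?R \<and> congruent_one K v x \<and>
      (\<forall>a\<in>A. \<psi> a * x = x * \<phi> a) \<longrightarrow>
      (\<exists>y \<in> twisted_power_series (valuation_ring UNIV v). x * y = 1 \<and> y * x = 1 \<and>
        w \<le> tl_val v (x - 1) \<and> w \<le> tl_val v (y - 1))"
    using unique y x_bound y_bound by blast
  ultimately show ?thesis by blast
qed

end
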